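(* Let $\mathcal{H}$ be a complex Hilbert space and let $A\in\mathbb{B}(\mathcal{H})$ be a positive contractive operator. Then for all $x,y\in\mathcal{H}$, \[ |\langle Ax,y\rangle|\le \frac{\|x\|\,\|y\|+|\langle x,y\rangle|}{2}. \]
   Context: $\mathbb{B}(\mathcal{H})$ is the algebra of all bounded linear operators on $\mathcal{H}$. An operator $A\in\mathbb{B}(\mathcal{H})$ is positive ($A\ge0$) if $\langle Ax,x\rangle\ge0$ for all $x\in\mathcal{H}$; for self-adjoint $A,B$, $A\le B$ means $B-A\ge0$. $A$ is positive contractive if $0\le A\le I$, where $I$ is the identity operator. *)

theory Defs
  imports "HOL-Analysis.Analysis"
begin

class complex_vector = real_vector +
  fixes scaleC :: "complex \<Rightarrow> 'a \<Rightarrow> 'a"  (infixr \<open>*\<^sub>C\<close> 75)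
  assumes scaleC_add_right: "a *\<^sub>C (x + y) = a *\<^sub>C x + a *\<^sub>C y"
    and scaleC_add_left: "(a + b) *\<^sub>C x = a *\<^sub>C x + b *\<^sub>C x"
    and scaleC_scaleC: "a *\<^sub>C (b *\<^sub>C x) = (a * b) *\<^sub>C x"
    and scaleC_one: "1 *\<^sub>C x = x"
    and scaleR_scaleC: "r *\<^sub>R x = complex_of_real r *\<^sub>C x"

text \<open>
  The inner product is linear in its first argument and conjugate-linear in its second.
  The triangle inequality inherited from \<^class>\<open>real_normed_vector\<close> is no restriction:
  it follows from the other axioms by the Cauchy--Schwarz inequality.
\<close>

class complex_inner = complex_vector + real_normed_vector +
  fixes cinner :: "'a \<Rightarrow> 'a \<Rightarrow> complex"
  assumes cinner_commute: "cinner x y = cnj (cinner y x)"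
    and cinner_add_left: "cinner (x + y) z = cinner x z + cinner y z"
    and cinner_scaleC_left: "cinner (c *\<^sub>C x) y = c * cinner x y"
    and cinner_nonneg: "cinner x x \<in> \<real>\<^sub>\<ge>\<^sub>0"
    and cinner_eq_zero_iff: "cinner x x = 0 \<longleftrightarrow> x = 0"
    and norm_eq_sqrt_cinner: "norm x = sqrt (Re (cinner x x))"

class chilbert_space = complex_inner + banach

instantiation complex :: chilbert_space
begin

definition scaleC_complex :: "complex \<Rightarrow> complex \<Rightarrow> complex"
  where "scaleC_complex c z = c * z"

definition cinner_complex :: "complex \<Rightarrow> complex \<Rightarrow> complex"
  where "cinner_complex z w = z * cnj w"

instance
proof
  fix x :: complex
  show "cinner x x \<in> \<real>\<^sub>\<ge>\<^sub>0"
    by (simp add: cinner_complex_def complex_nonneg_Reals_iff)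
  show "norm x = sqrt (Re (cinner x x))"
    by (simp add: cinner_complex_def cmod_def power2_eq_square)
qed (simp_all add: scaleC_complex_def cinner_complex_def algebra_simps scaleR_conv_of_real)

end

definition bounded_clinear :: "('a::complex_inner \<Rightarrow> 'b::complex_inner) \<Rightarrow> bool"
  where "bounded_clinear A \<longleftrightarrow> bounded_linear A \<and> (\<forall>c x. A (c *\<^sub>C x) = c *\<^sub>C A x)"

definition positive_op :: "('a::complex_inner \<Rightarrow> 'a) \<Rightarrow> bool"
  where "positive_op A \<longleftrightarrow> (\<forall>x. cinner (A x) x \<in> \<real>\<^sub>\<ge>\<^sub>0)"

text \<open>
  The order is used for self-adjoint operators. Self-adjointness is not part of the definition,
  because over the complex field a positive operator is automatically self-adjoint.
\<close>

definition op_le :: "('a::complex_inner \<Rightarrow> 'a) \<Rightarrow> ('a \<Rightarrow> 'a) \<Rightarrow> bool"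
  where "op_le A B \<longleftrightarrow> positive_op (\<lambda>x. B x - A x)"

definition positive_contractive :: "('a::complex_inner \<Rightarrow> 'a) \<Rightarrow> bool"
  where "positive_contractive A \<longleftrightarrow> positive_op A \<and> op_le A id"

end

theory Submission
  imports Defs
begin

text \<open>
  Both \<open>A\<close> and its complement \<open>I - A\<close> are positive, so each of them defines a positive semidefinite
  sesquilinear form, and these two forms add up to the inner product. A positive semidefinite form
  \<open>p\<close> satisfies \<open>2 |p(x,y)| \<le> p(x,x) + p(y,y)\<close> (\<open>positive_form_le_mean\<close>). Adding this inequality for
  the two forms bounds \<open>2 (|\<langle>Ax,y\<rangle>| + |\<langle>(I - A)x,y\<rangle>|)\<close> by \<open>\<parallel>x\<parallel>\<^sup>2 + \<parallel>y\<parallel>\<^sup>2\<close>, and homogeneity sharpens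
  the bound to \<open>|\<langle>Ax,y\<rangle>| + |\<langle>(I - A)x,y\<rangle>| \<le> \<parallel>x\<parallel> \<parallel>y\<parallel>\<close> (\<open>cmod_cinner_complement_sum_le\<close>). The theorem
  follows because \<open>\<langle>(I - A)x,y\<rangle> = \<langle>x,y\<rangle> - \<langle>Ax,y\<rangle>\<close>, so the second summand is at least
  \<open>|\<langle>Ax,y\<rangle>| - |\<langle>x,y\<rangle>|\<close>.
\<close>

lemma cinner_add_right: "cinner x (y + z) = cinner x y + cinner x z"
  by (metis cinner_add_left cinner_commute complex_cnj_add)

lemma cinner_scaleC_right: "cinner x (c *\<^sub>C y) = cnj c * cinner x y"
  by (metis cinner_commute cinner_scaleC_left complex_cnj_mult)

lemma cinner_scaleR_left: "cinner (r *\<^sub>R x) y = complex_of_real r * cinner x y"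
  by (simp add: scaleR_scaleC cinner_scaleC_left)

lemma cinner_scaleR_right: "cinner x (r *\<^sub>R y) = complex_of_real r * cinner x y"
  by (simp add: scaleR_scaleC cinner_scaleC_right)

lemma cinner_zero_left: "cinner 0 y = 0"
  using cinner_scaleR_left[of 0 0 y] by simp

lemma cinner_zero_right: "cinner x 0 = 0"
  using cinner_scaleR_right[of x 0 0] by simp

lemma cinner_diff_left: "cinner (x - y) z = cinner x z - cinner y z"
  using cinner_add_left[of "x - y" y z] by simp

lemma Re_cinner_self: "Re (cinner x x) = (norm x)\<^sup>2"
  using cinner_nonneg[of x] by (simp add: norm_eq_sqrt_cinner complex_nonneg_Reals_iff)

lemma bounded_clinear_complement:
  assumes "bounded_clinear A"
  shows "bounded_clinear (\<lambda>x. x - A x)"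
proof -
  have "c *\<^sub>C x - c *\<^sub>C A x = c *\<^sub>C (x - A x)" for c x
    using scaleC_add_right[of c "x - A x" "A x"] by simp
  then show ?thesis
    using assms by (simp add: bounded_clinear_def bounded_linear_sub)
qed

lemma quadratic_form_expand:
  assumes "bounded_clinear P"
  shows "cinner (P (x + c *\<^sub>C y)) (x + c *\<^sub>C y) =
    cinner (P x) x + cnj c * cinner (P x) y + c * cinner (P y) x
      + c * cnj c * cinner (P y) y"
proof -
  have "P (x + c *\<^sub>C y) = P x + c *\<^sub>C P y"
    using assms by (simp add: bounded_clinear_def bounded_linear.linear linear_add)
  then show ?thesis
    by (simp add: cinner_add_left cinner_add_right cinner_scaleC_left cinner_scaleC_right
        algebra_simps)
qed

text \<open>
  The quadratic form takes only real values. Vanishing of the imaginary part at \<open>x + y\<close> relates the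
  imaginary parts of \<open>\<langle>Px,y\<rangle>\<close> and \<open>\<langle>Py,x\<rangle>\<close>, and vanishing at \<open>x + \<i>y\<close> relates their real parts.
\<close>

lemma positive_form_hermitian:
  assumes "bounded_clinear P" and "positive_op P"
  shows "cinner (P y) x = cnj (cinner (P x) y)"
proof -
  have real: "Im (cinner (P z) z) = 0" for z
    using assms(2) by (simp add: positive_op_def complex_nonneg_Reals_iff)
  have "Im (cinner (P x) y) + Im (cinner (P y) x) = 0"
    using real[of "x + 1 *\<^sub>C y"] real[of x] real[of y]
    by (simp only: quadratic_form_expand[OF assms(1)]) simp
  moreover have "Re (cinner (P y) x) = Re (cinner (P x) y)"
    using real[of "x + \<i> *\<^sub>C y"] real[of x] real[of y]
    by (simp only: quadratic_form_expand[OF assms(1)]) simp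
  ultimately show ?thesis
    by (simp add: complex_eq_iff)
qed

text \<open>
  Positivity of the form at \<open>x + c y\<close>, with \<open>|c| = 1\<close> chosen so that the cross terms are as negative
  as possible, gives this weak version of the Cauchy--Schwarz inequality. Its right-hand side is
  additive in the form, unlike the geometric mean, so that the inequalities for \<open>A\<close> and \<open>I - A\<close>
  can simply be added.
\<close>

lemma positive_form_le_mean:
  assumes "bounded_clinear P" and "positive_op P"
  shows "2 * cmod (cinner (P x) y) \<le> Re (cinner (P x) x) + Re (cinner (P y) y)"
proof (cases "cinner (P x) y = 0")
  case True
  then show ?thesis
    using assms(2) by (simp add: positive_op_def complex_nonneg_Reals_iff)
next
  case False
  define p where "p = cinner (P x) y"
  \<comment> \<open>The phase of \<open>p\<close> turns both cross terms of the quadratic form at \<open>x + c y\<close> into \<open>- |p|\<close>.\<close>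
  define c where "c = - sgn p"
  have p: "cnj c * p = - complex_of_real (cmod p)" and c: "c * cnj c = 1"
    using False complex_norm_square[of p]
    by (simp_all add: c_def p_def sgn_eq field_simps power2_eq_square)
  have swapped: "c * cinner (P y) x = - complex_of_real (cmod p)"
    using arg_cong[OF p, of cnj] positive_form_hermitian[OF assms, of y x] by (simp add: p_def)
  have "0 \<le> Re (cinner (P (x + c *\<^sub>C y)) (x + c *\<^sub>C y))"
    using assms(2) by (simp add: positive_op_def complex_nonneg_Reals_iff)
  also have "\<dots> = Re (cinner (P x) x) - 2 * cmod p + Re (cinner (P y) y)"
    by (simp only: quadratic_form_expand[OF assms(1)] p[unfolded p_def] swapped c)
      (simp add: p_def)
  finally show ?thesis
    by (simp add: p_def)
qed

lemma cmod_cinner_complement_sum_le: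
  assumes lin: "bounded_clinear A" and pos: "positive_contractive A"
  shows "cmod (cinner (A x) y) + cmod (cinner (x - A x) y) \<le> norm x * norm y"
proof -
  have posA: "positive_op A" and posB: "positive_op (\<lambda>x. x - A x)"
    using pos by (simp_all add: positive_contractive_def op_le_def)
  have sum_le: "2 * (cmod (cinner (A u) v) + cmod (cinner (u - A u) v)) \<le> (norm u)\<^sup>2 + (norm v)\<^sup>2"
    for u v
    using positive_form_le_mean[OF lin posA, of u v]
      positive_form_le_mean[OF bounded_clinear_complement[OF lin] posB, of u v]
    by (simp add: cinner_diff_left Re_cinner_self)
  have scale: "A (r *\<^sub>R x) = r *\<^sub>R A x" for r
    using lin by (simp add: bounded_clinear_def bounded_linear.linear linear_scale)
  define s where "s = cmod (cinner (A x) y) + cmod (cinner (x - A x) y)"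
  show ?thesis
  proof (cases "x = 0 \<or> y = 0")
    case True
    then show ?thesis
      using scale[of 0] by (auto simp: cinner_zero_left cinner_zero_right)
  next
    case False
    then have nz: "norm x > 0" "norm y > 0"
      by simp_all
    \<comment> \<open>Multiplying \<open>x\<close> by \<open>\<parallel>y\<parallel>\<close> and \<open>y\<close> by \<open>\<parallel>x\<parallel>\<close> makes the two norms equal, which is where the
      arithmetic mean of the squared norms equals their product.\<close>
    have "2 * (norm y * norm x * s) \<le> 2 * (norm y * norm x * (norm x * norm y))"
      using sum_le[of "norm y *\<^sub>R x" "norm x *\<^sub>R y"]
      by (simp add: s_def scale scaleR_diff_right[symmetric] cinner_scaleR_left
          cinner_scaleR_right norm_mult power2_eq_square distrib_left mult_ac)
    then show ?thesis
      using nz by (simp add: s_def)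
  qed
qed

theorem corollary3p2:
  fixes A :: "'a::chilbert_space \<Rightarrow> 'a"
  assumes "bounded_clinear A"
    and "positive_contractive A"
  shows "\<forall>x y. cmod (cinner (A x) y) \<le> (norm x * norm y + cmod (cinner x y)) / 2"
proof (intro allI)
  fix x y :: 'a
  have "cmod (cinner (A x) y) \<le> cmod (cinner x y) + cmod (cinner (x - A x) y)"
    using norm_triangle_ineq4[of "cinner x y" "cinner (x - A x) y"]
    by (simp add: cinner_diff_left)
  then show "cmod (cinner (A x) y) \<le> (norm x * norm y + cmod (cinner x y)) / 2"
    using cmod_cinner_complement_sum_le[OF assms, of x y] by simp
qed

end
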